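(* Let $X$ be a Helly graph with finite combinatorial dimension and let $L\ge1$ be an integer. Then any bi-infinite local $L$-clique-path $(\sigma_n)_{n\in\mathbb{Z}}$ in $X$ is an $L$-clique-path.
   Context: A connected graph $X$ (identified with its vertex set with graph metric $d$) is Helly if any family of pairwise intersecting combinatorial balls has non-empty global intersection. A clique is a non-empty set of pairwise adjacent vertices (not necessarily maximal). The combinatorial dimension of $X$ is the topological dimension of the injective hull $EX$ of its vertex set, i.e. of the essentially unique minimal injective metric space containing it isometrically (a geodesic metric space is injective if any family of pairwise intersecting closed balls has non-empty global intersection). Two cliques $\sigma,\tau$ are at transverse distance $n\ge 0$, denoted $\sigma\lessgtr\tau=n$, if: (i) for every $x\in\sigma$, $y\in\tau$ we have $d(x,y)\ge n$; (ii) there exists $x\in\sigma$ such that $d(x,y)=n$ for all $y\in\tau$; (iii) there exists $y\in\tau$ such that $d(x,y)=n$ for all $x\in\sigma$. A (finite or bi-infinite) sequence of pairwise disjoint cliques $(\sigma_i)_i$ is an $L$-clique-path if: for all indices $i<j$, $\sigma_i\lessgtr\sigma_j=(j-i)L$; and for every index $i$ that is not an endpoint, $\sigma_i$ is maximal (for inclusion) among the cliques $\sigma$ satisfying $\sigma\lessgtr\sigma_{i+1}=L$ and $\sigma\lessgtr\sigma_{i-1}=L$. The sequence is a local $L$-clique-path if every three consecutive terms $\sigma_i,\sigma_{i+1},\sigma_{i+2}$ form an $L$-clique-path. *)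

theory Defs
  imports "HOL-Analysis.Analysis"
begin

section \<open>Helly graphs\<close>

text \<open>A simple graph, possibly infinite, is given by its vertex set V and its adjacency relation E.\<close>

definition connected_simple_graph :: "'v set \<Rightarrow> 'v rel \<Rightarrow> bool" where
  "connected_simple_graph V E \<longleftrightarrow>
     V \<noteq> {} \<and> E \<subseteq> V \<times> V \<and> sym E \<and> irrefl E \<and> (\<forall>x\<in>V. \<forall>y\<in>V. (x, y) \<in> E\<^sup>*)"

definition graph_dist :: "'v rel \<Rightarrow> 'v \<Rightarrow> 'v \<Rightarrow> nat" where
  "graph_dist E x y = (LEAST n. (x, y) \<in> E ^^ n)"

definition graph_ball :: "'v set \<Rightarrow> 'v rel \<Rightarrow> 'v \<Rightarrow> nat \<Rightarrow> 'v set" where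
  "graph_ball V E x r = {y \<in> V. graph_dist E x y \<le> r}"

definition Helly_graph :: "'v set \<Rightarrow> 'v rel \<Rightarrow> bool" where
  "Helly_graph V E \<longleftrightarrow> connected_simple_graph V E \<and>
     (\<forall>F. (\<forall>B\<in>F. \<exists>x\<in>V. \<exists>r. B = graph_ball V E x r) \<and> (\<forall>B\<in>F. \<forall>C\<in>F. B \<inter> C \<noteq> {})
        \<longrightarrow> \<Inter>F \<noteq> {})"


section \<open>Injective hulls and topological dimension\<close>

definition geodesic_metric :: "'b metric \<Rightarrow> bool" where
  "geodesic_metric M \<longleftrightarrow>
     (\<forall>x\<in>mspace M. \<forall>y\<in>mspace M. \<exists>g :: real \<Rightarrow> 'b.
        g ` {0..mdist M x y} \<subseteq> mspace M \<and> g 0 = x \<and> g (mdist M x y) = y \<and>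
        (\<forall>s\<in>{0..mdist M x y}. \<forall>t\<in>{0..mdist M x y}. mdist M (g s) (g t) = \<bar>s - t\<bar>))"

definition injective_metric :: "'b metric \<Rightarrow> bool" where
  "injective_metric M \<longleftrightarrow> geodesic_metric M \<and>
     (\<forall>F. (\<forall>B\<in>F. \<exists>x\<in>mspace M. \<exists>r. B = mcball_of M x r) \<and> (\<forall>B\<in>F. \<forall>C\<in>F. B \<inter> C \<noteq> {})
        \<longrightarrow> \<Inter>F \<noteq> {})"

text \<open>
  H, together with the isometric embedding e, is an injective hull of the set V with distance d:
  minimality means that no proper subspace of H containing the image of V is injective.
\<close>

definition injective_hull ::
    "'v set \<Rightarrow> ('v \<Rightarrow> 'v \<Rightarrow> real) \<Rightarrow> 'b metric \<Rightarrow> ('v \<Rightarrow> 'b) \<Rightarrow> bool" where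
  "injective_hull V d H e \<longleftrightarrow>
     injective_metric H \<and>
     e ` V \<subseteq> mspace H \<and> (\<forall>x\<in>V. \<forall>y\<in>V. mdist H (e x) (e y) = d x y) \<and>
     (\<forall>A. e ` V \<subseteq> A \<and> A \<subseteq> mspace H \<and> injective_metric (submetric H A) \<longrightarrow> A = mspace H)"

text \<open>
  Topological dimension is Lebesgue covering dimension: every finite open cover has a finite open
  refinement such that no point lies in more than n + 1 of its members.  (The library's
  \<^term>\<open>dimension_le\<close> is the small inductive dimension, which in general differs from it on
  non-separable metric spaces, and injective hulls need not be separable.)  The empty space gets
  dimension 0 here rather than -1.
\<close>

definition covering_dim_le :: "'b topology \<Rightarrow> nat \<Rightarrow> bool" where
  "covering_dim_le T n \<longleftrightarrow>
     (\<forall>\<U>. finite \<U> \<and> (\<forall>U\<in>\<U>. openin T U) \<and> \<Union>\<U> = topspace T \<longrightarrow>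
        (\<exists>\<W>. finite \<W> \<and> (\<forall>W\<in>\<W>. openin T W) \<and> \<Union>\<W> = topspace T \<and>
             (\<forall>W\<in>\<W>. \<exists>U\<in>\<U>. W \<subseteq> U) \<and>
             (\<forall>x\<in>topspace T. card {W \<in> \<W>. x \<in> W} \<le> n + 1)))"

definition topological_dim :: "'b topology \<Rightarrow> enat" where
  "topological_dim T = Inf {enat n | n. covering_dim_le T n}"


section \<open>Clique-paths\<close>

definition clique :: "'v set \<Rightarrow> 'v rel \<Rightarrow> 'v set \<Rightarrow> bool" where
  "clique V E \<sigma> \<longleftrightarrow> \<sigma> \<noteq> {} \<and> \<sigma> \<subseteq> V \<and> (\<forall>x\<in>\<sigma>. \<forall>y\<in>\<sigma>. x \<noteq> y \<longrightarrow> (x, y) \<in> E)"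

definition transverse_dist :: "'v rel \<Rightarrow> 'v set \<Rightarrow> 'v set \<Rightarrow> nat \<Rightarrow> bool" where
  "transverse_dist E \<sigma> \<tau> n \<longleftrightarrow>
     (\<forall>x\<in>\<sigma>. \<forall>y\<in>\<tau>. graph_dist E x y \<ge> n) \<and>
     (\<exists>x\<in>\<sigma>. \<forall>y\<in>\<tau>. graph_dist E x y = n) \<and>
     (\<exists>y\<in>\<tau>. \<forall>x\<in>\<sigma>. graph_dist E x y = n)"

text \<open>
  The index set I of a sequence is an interval of integers: UNIV for a bi-infinite sequence, a
  bounded interval for a finite one.  An index i of I is not an endpoint iff i - 1 and i + 1 lie
  in I.
\<close>

definition disjoint_clique_sequence ::
    "'v set \<Rightarrow> 'v rel \<Rightarrow> int set \<Rightarrow> (int \<Rightarrow> 'v set) \<Rightarrow> bool" where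
  "disjoint_clique_sequence V E I \<sigma> \<longleftrightarrow> (\<forall>i\<in>I. clique V E (\<sigma> i)) \<and> disjoint_family_on \<sigma> I"

definition clique_path ::
    "'v set \<Rightarrow> 'v rel \<Rightarrow> nat \<Rightarrow> int set \<Rightarrow> (int \<Rightarrow> 'v set) \<Rightarrow> bool" where
  "clique_path V E L I \<sigma> \<longleftrightarrow>
     disjoint_clique_sequence V E I \<sigma> \<and>
     (\<forall>i\<in>I. \<forall>j\<in>I. i < j \<longrightarrow> transverse_dist E (\<sigma> i) (\<sigma> j) (nat (j - i) * L)) \<and>
     (\<forall>i\<in>I. i - 1 \<in> I \<and> i + 1 \<in> I \<longrightarrow>
        (\<forall>\<tau>. clique V E \<tau> \<and> transverse_dist E \<tau> (\<sigma> (i + 1)) L \<and>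
             transverse_dist E \<tau> (\<sigma> (i - 1)) L \<and> \<sigma> i \<subseteq> \<tau> \<longrightarrow> \<tau> = \<sigma> i))"

definition local_clique_path ::
    "'v set \<Rightarrow> 'v rel \<Rightarrow> nat \<Rightarrow> int set \<Rightarrow> (int \<Rightarrow> 'v set) \<Rightarrow> bool" where
  "local_clique_path V E L I \<sigma> \<longleftrightarrow>
     disjoint_clique_sequence V E I \<sigma> \<and>
     (\<forall>i. {i..i + 2} \<subseteq> I \<longrightarrow> clique_path V E L {i..i + 2} \<sigma>)"

end

theory Submission
  imports Defs
begin

text \<open>
  Write \<open>d\<close> for the graph distance.  Each \<open>\<sigma> i\<close> contains vertices at distance exactly \<open>L\<close> from all
  of \<open>\<sigma> (i + 1)\<close>, its forward vertices, and vertices at distance exactly \<open>L\<close> from all of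
  \<open>\<sigma> (i - 1)\<close>, its backward vertices.  Steps of length \<open>L\<close> through forward vertices connect a
  forward vertex of \<open>\<sigma> i\<close> to every vertex of \<open>\<sigma> (i + n)\<close>, and steps through backward vertices
  connect a backward vertex of \<open>\<sigma> j\<close> to every vertex of \<open>\<sigma> (j - n)\<close>; so all upper bounds \<open>n L\<close>
  that transversality asks for are immediate, and only the lower bounds need an argument.

  The lower bound is proved first between a forward vertex \<open>x\<close> of \<open>\<sigma> i\<close> and a backward vertex \<open>t\<close>
  of \<open>\<sigma> (i + n)\<close>, by induction on \<open>n\<close>.  If \<open>d x t < n L\<close>, the Helly property produces a vertex \<open>v\<close>
  with \<open>d v t \<le> L\<close> and \<open>d x v < (n - 1) L\<close> that is moreover within \<open>1\<close> of all of \<open>\<sigma> (i + n - 1)\<close> and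
  within \<open>L\<close> of all of \<open>\<sigma> (i + n - 2)\<close>.  The last two conditions are what allows \<open>v\<close> to be added to
  \<open>\<sigma> (i + n - 1)\<close> without losing transversality to its two neighbours; by maximality \<open>v\<close> already
  belongs to that clique, as one of its backward vertices, and it contradicts the induction
  hypothesis (lemma \<open>forward_backward_dist\<close>).

  Arbitrary vertices \<open>u\<close> of \<open>\<sigma> i\<close> and \<open>w\<close> of \<open>\<sigma> j\<close> can fail to be forward and backward vertices,
  but the sequence is bi-infinite: \<open>u\<close> is at distance \<open>L\<close> from a forward vertex of \<open>\<sigma> (i - 1)\<close> and
  \<open>w\<close> is at distance \<open>L\<close> from a backward vertex of \<open>\<sigma> (j + 1)\<close>.  These two are at distance at
  least \<open>(j - i + 2) L\<close>, so \<open>d u w \<ge> (j - i) L\<close> by the triangle inequality.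
\<close>

section \<open>The path metric of a connected graph\<close>

locale connected_graph =
  fixes V :: "'v set" and E :: "'v rel"
  assumes connected: "connected_simple_graph V E"
begin

abbreviation d :: "'v \<Rightarrow> 'v \<Rightarrow> nat" where "d \<equiv> graph_dist E"

lemma edges_in_V: "E \<subseteq> V \<times> V" and sym_edges: "sym E"
  and reachable: "x \<in> V \<Longrightarrow> y \<in> V \<Longrightarrow> (x, y) \<in> E\<^sup>*"
  using connected unfolding connected_simple_graph_def by auto

lemma dist_walk:
  assumes "x \<in> V" "y \<in> V"
  shows "(x, y) \<in> E ^^ d x y"
proof -
  obtain n where "(x, y) \<in> E ^^ n"
    using reachable[OF assms] rtrancl_imp_relpow by blast
  then show ?thesis
    unfolding graph_dist_def by (rule LeastI)
qed

lemma dist_le_walk: "(x, y) \<in> E ^^ n \<Longrightarrow> d x y \<le> n"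
  unfolding graph_dist_def by (rule Least_le)

lemma walk_sym: "(x, y) \<in> E ^^ n \<Longrightarrow> (y, x) \<in> E ^^ n"
proof (induction n arbitrary: y)
  case (Suc n)
  then obtain z where "(x, z) \<in> E ^^ n" "(z, y) \<in> E" by auto
  then show ?case
    using Suc.IH sym_edges by (meson relpow_Suc_I2 symD)
qed simp

lemma walk_in_V: "(x, y) \<in> E ^^ n \<Longrightarrow> x \<in> V \<Longrightarrow> y \<in> V"
  using edges_in_V by (cases n) auto

lemma dist_self [simp]: "d x x = 0"
  using dist_le_walk[of x x 0] by simp

lemma dist_sym: "d x y = d y x"
  unfolding graph_dist_def by (metis walk_sym)

lemma dist_triangle:
  assumes "x \<in> V" "y \<in> V" "z \<in> V"
  shows "d x z \<le> d x y + d y z"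
proof (rule dist_le_walk)
  show "(x, z) \<in> E ^^ (d x y + d y z)"
    using dist_walk[OF assms(1,2)] dist_walk[OF assms(2,3)] by (auto simp: relpow_add)
qed

lemma dist_le_1_iff:
  assumes "x \<in> V" "y \<in> V"
  shows "d x y \<le> 1 \<longleftrightarrow> x = y \<or> (x, y) \<in> E"
proof
  assume "d x y \<le> 1"
  then consider "d x y = 0" | "d x y = 1" by linarith
  then show "x = y \<or> (x, y) \<in> E"
    using dist_walk[OF assms] by cases auto
qed (use dist_le_walk[of x y 1] in auto)

lemma clique_iff_diameter_le_1:
  "clique V E \<tau> \<longleftrightarrow> \<tau> \<noteq> {} \<and> \<tau> \<subseteq> V \<and> (\<forall>x\<in>\<tau>. \<forall>y\<in>\<tau>. d x y \<le> 1)"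
proof -
  have "(\<forall>x\<in>\<tau>. \<forall>y\<in>\<tau>. d x y \<le> 1) \<longleftrightarrow> (\<forall>x\<in>\<tau>. \<forall>y\<in>\<tau>. x \<noteq> y \<longrightarrow> (x, y) \<in> E)" if "\<tau> \<subseteq> V"
    using that dist_le_1_iff by (intro ball_cong refl) (metis subsetD)
  then show ?thesis
    unfolding clique_def by (auto simp del: One_nat_def)
qed

lemma geodesic_split:
  assumes "x \<in> V" "y \<in> V" "d x y \<le> r + s"
  shows "\<exists>z\<in>V. d x z \<le> r \<and> d y z \<le> s"
proof (cases "d x y \<le> r")
  case True
  then show ?thesis using assms(2) by auto
next
  case False
  define k where "k = d x y - r"
  have "d x y = r + k" "k \<le> s"
    using False assms(3) by (auto simp: k_def)
  then have "(x, y) \<in> E ^^ r O E ^^ k"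
    using dist_walk[OF assms(1,2)] by (simp add: relpow_add)
  then obtain z where z: "(x, z) \<in> E ^^ r" "(z, y) \<in> E ^^ k" by auto
  have "z \<in> V" using walk_in_V[OF z(1) assms(1)] .
  moreover have "d x z \<le> r" using dist_le_walk[OF z(1)] .
  moreover have "d y z \<le> s"
    using dist_le_walk[OF walk_sym[OF z(2)]] \<open>k \<le> s\<close> by simp
  ultimately show ?thesis by blast
qed

text \<open>
  Two balls of a graph meet as soon as their centres are no farther apart than the sum of the
  radii, so the Helly property becomes a condition on distances between centres.
\<close>

lemma Helly_common_point:
  assumes Helly: "Helly_graph V E"
    and centres: "\<And>x r. (x, r) \<in> P \<Longrightarrow> x \<in> V" and "P \<noteq> {}"
    and close: "\<And>x r y s. (x, r) \<in> P \<Longrightarrow> (y, s) \<in> P \<Longrightarrow> d x y \<le> r + s"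
  obtains v where "v \<in> V" "\<And>x r. (x, r) \<in> P \<Longrightarrow> d x v \<le> r"
proof -
  define F where "F = (\<lambda>(x, r). graph_ball V E x r) ` P"
  have "B \<inter> C \<noteq> {}" if BC: "B \<in> F" "C \<in> F" for B C
  proof -
    obtain x r y s where xy: "(x, r) \<in> P" "(y, s) \<in> P"
      and "B = graph_ball V E x r" "C = graph_ball V E y s"
      using BC by (auto simp: F_def)
    then show ?thesis
      using geodesic_split[OF centres[OF xy(1)] centres[OF xy(2)] close[OF xy]]
      unfolding graph_ball_def by auto
  qed
  moreover have "\<forall>B\<in>F. \<exists>x\<in>V. \<exists>r. B = graph_ball V E x r"
    using centres by (fastforce simp: F_def)
  ultimately have "\<Inter>F \<noteq> {}"
    using Helly unfolding Helly_graph_def by blast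
  then obtain v where "v \<in> \<Inter>F" by blast
  then have v: "v \<in> graph_ball V E x r" if "(x, r) \<in> P" for x r
    using that by (auto simp: F_def)
  show ?thesis
  proof (rule that)
    show "v \<in> V"
      using v \<open>P \<noteq> {}\<close> unfolding graph_ball_def by auto
    show "d x v \<le> r" if "(x, r) \<in> P" for x r
      using v[OF that] unfolding graph_ball_def by auto
  qed
qed

end


section \<open>Forward and backward vertices of a local clique-path\<close>

locale biinfinite_local_clique_path = connected_graph V E
  for V :: "'v set" and E :: "'v rel" +
  fixes L :: nat and \<sigma> :: "int \<Rightarrow> 'v set"
  assumes L: "L \<ge> 1"
    and local_path: "local_clique_path V E L UNIV \<sigma>"
begin

definition forward :: "int \<Rightarrow> 'v set" where
  "forward i = {x \<in> \<sigma> i. \<forall>y\<in>\<sigma> (i + 1). d x y = L}"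

definition backward :: "int \<Rightarrow> 'v set" where
  "backward i = {y \<in> \<sigma> i. \<forall>x\<in>\<sigma> (i - 1). d x y = L}"

lemma triple_path: "clique_path V E L {i..i + 2} \<sigma>"
  using local_path unfolding local_clique_path_def by simp

lemma transverse_next: "transverse_dist E (\<sigma> i) (\<sigma> (i + 1)) L"
proof -
  have "\<forall>j\<in>{i..i + 2}. \<forall>k\<in>{i..i + 2}. j < k \<longrightarrow> transverse_dist E (\<sigma> j) (\<sigma> k) (nat (k - j) * L)"
    using triple_path[of i] unfolding clique_path_def by blast
  from this[rule_format, of i "i + 1"] show ?thesis by simp
qed

lemma transverse_next2: "transverse_dist E (\<sigma> i) (\<sigma> (i + 2)) (2 * L)"
proof -
  have "\<forall>j\<in>{i..i + 2}. \<forall>k\<in>{i..i + 2}. j < k \<longrightarrow> transverse_dist E (\<sigma> j) (\<sigma> k) (nat (k - j) * L)"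
    using triple_path[of i] unfolding clique_path_def by blast
  from this[rule_format, of i "i + 2"] show ?thesis by simp
qed

lemma clique_maximal:
  assumes "clique V E \<tau>" "transverse_dist E \<tau> (\<sigma> (i + 1)) L"
    "transverse_dist E \<tau> (\<sigma> (i - 1)) L" "\<sigma> i \<subseteq> \<tau>"
  shows "\<tau> = \<sigma> i"
proof -
  have "\<forall>j\<in>{i - 1..i - 1 + 2}. j - 1 \<in> {i - 1..i - 1 + 2} \<and> j + 1 \<in> {i - 1..i - 1 + 2} \<longrightarrow>
      (\<forall>\<tau>. clique V E \<tau> \<and> transverse_dist E \<tau> (\<sigma> (j + 1)) L \<and>
           transverse_dist E \<tau> (\<sigma> (j - 1)) L \<and> \<sigma> j \<subseteq> \<tau> \<longrightarrow> \<tau> = \<sigma> j)"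
    using triple_path[of "i - 1"] unfolding clique_path_def by blast
  from this[rule_format, of i \<tau>] show ?thesis using assms by simp
qed

lemma sigma_clique: "clique V E (\<sigma> i)"
  using local_path unfolding local_clique_path_def disjoint_clique_sequence_def by simp

lemma sigma_in_V: "x \<in> \<sigma> i \<Longrightarrow> x \<in> V"
  using sigma_clique[of i] unfolding clique_def by blast

lemma sigma_diameter: "x \<in> \<sigma> i \<Longrightarrow> y \<in> \<sigma> i \<Longrightarrow> d x y \<le> 1"
  using sigma_clique[of i] unfolding clique_iff_diameter_le_1 by blast

lemma forward_in_sigma: "x \<in> forward i \<Longrightarrow> x \<in> \<sigma> i"
  and forward_dist: "x \<in> forward i \<Longrightarrow> y \<in> \<sigma> (i + 1) \<Longrightarrow> d x y = L"
  unfolding forward_def by auto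

lemma backward_in_sigma: "y \<in> backward i \<Longrightarrow> y \<in> \<sigma> i"
  and backward_dist: "y \<in> backward i \<Longrightarrow> x \<in> \<sigma> (i - 1) \<Longrightarrow> d x y = L"
  unfolding backward_def by auto

lemma forward_nonempty: "\<exists>x. x \<in> forward i"
  using transverse_next[of i] unfolding transverse_dist_def forward_def by blast

lemma backward_nonempty: "\<exists>y. y \<in> backward i"
  using transverse_next[of "i - 1"] unfolding transverse_dist_def backward_def by auto

lemma sigma_next_dist:
  assumes "x \<in> \<sigma> i" "y \<in> \<sigma> (i + 1)"
  shows "d x y \<le> L + 1"
proof -
  obtain s where s: "s \<in> forward i" using forward_nonempty by blast
  have "d x y \<le> d x s + d s y"
    using assms s by (intro dist_triangle) (auto intro: sigma_in_V forward_in_sigma)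
  moreover have "d x s \<le> 1" using sigma_diameter[OF assms(1) forward_in_sigma[OF s]] .
  moreover have "d s y = L" using forward_dist[OF s assms(2)] .
  ultimately show ?thesis by linarith
qed

lemma sigma_next2_dist: "x \<in> \<sigma> i \<Longrightarrow> y \<in> \<sigma> (i + 2) \<Longrightarrow> 2 * L \<le> d x y"
  using transverse_next2[of i] unfolding transverse_dist_def by blast

text \<open>
  The number of steps is \<open>Suc n\<close> because the bound fails for zero steps: two vertices of the same
  clique may be at distance \<open>1\<close>.
\<close>

lemma forward_dist_le:
  assumes "x \<in> forward i" "y \<in> \<sigma> (i + 1 + int n)"
  shows "d x y \<le> Suc n * L"
  using assms(2)
proof (induction n arbitrary: y)
  case 0
  then show ?case using forward_dist[OF assms(1)] by simp
next
  case (Suc n)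
  obtain s where s: "s \<in> forward (i + 1 + int n)" using forward_nonempty by blast
  have "d x s \<le> Suc n * L" using Suc.IH[OF forward_in_sigma[OF s]] .
  moreover have "d s y = L"
    using Suc.prems by (intro forward_dist[OF s]) (simp add: algebra_simps)
  moreover have "d x y \<le> d x s + d s y"
    using assms(1) s Suc.prems
    by (intro dist_triangle) (auto intro: sigma_in_V forward_in_sigma)
  ultimately show ?case by simp
qed

lemma backward_dist_le:
  assumes "y \<in> backward j" "x \<in> \<sigma> (j - 1 - int n)"
  shows "d x y \<le> Suc n * L"
  using assms(2)
proof (induction n arbitrary: x)
  case 0
  then show ?case using backward_dist[OF assms(1)] by simp
next
  case (Suc n)
  obtain s where s: "s \<in> backward (j - 1 - int n)" using backward_nonempty by blast
  have "d s y \<le> Suc n * L" using Suc.IH[OF backward_in_sigma[OF s]] .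
  moreover have "d x s = L"
    using Suc.prems by (intro backward_dist[OF s]) (simp add: algebra_simps)
  moreover have "d x y \<le> d x s + d s y"
    using assms(1) s Suc.prems
    by (intro dist_triangle) (auto intro: sigma_in_V backward_in_sigma)
  ultimately show ?case by simp
qed

text \<open>
  A vertex that is close enough to three consecutive cliques to be added to the middle one is in
  the middle one: the outer cliques are at distance \<open>2 L\<close> from each other, so being within \<open>L\<close> of
  \<open>t\<close> and of all of \<open>\<sigma> (i - 1)\<close> forces these distances to be exactly \<open>L\<close> and those to the rest of
  \<open>\<sigma> (i + 1)\<close> to be at least \<open>L\<close>.  On the right a single backward vertex suffices, because transversality of the enlarged clique to its right neighbour asks only for one vertex
  there that is at distance \<open>L\<close> from the whole clique.
\<close>

lemma between_imp_backward:
  assumes "v \<in> V" and t: "t \<in> backward (i + 1)" "d v t \<le> L"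
    and left: "\<And>r. r \<in> \<sigma> (i - 1) \<Longrightarrow> d r v \<le> L"
    and middle: "\<And>q. q \<in> \<sigma> i \<Longrightarrow> d q v \<le> 1"
  shows "v \<in> backward i"
proof -
  have gap: "2 * L \<le> d r v + d v w" if "r \<in> \<sigma> (i - 1)" "w \<in> \<sigma> (i + 1)" for r w
  proof -
    have "2 * L \<le> d r w" using sigma_next2_dist[of r "i - 1" w] that by (simp add: algebra_simps)
    also have "d r w \<le> d r v + d v w"
      using that \<open>v \<in> V\<close> by (intro dist_triangle) (auto intro: sigma_in_V)
    finally show ?thesis .
  qed
  have t_in: "t \<in> \<sigma> (i + 1)" using backward_in_sigma[OF t(1)] .
  have left_eq: "d r v = L" if "r \<in> \<sigma> (i - 1)" for r
    using gap[OF that t_in] left[OF that] t(2) by linarith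
  obtain s where s: "s \<in> forward (i - 1)" using forward_nonempty by blast
  have s_in: "s \<in> \<sigma> (i - 1)" using forward_in_sigma[OF s] .
  have right_ge: "L \<le> d v w" if "w \<in> \<sigma> (i + 1)" for w
    using gap[OF s_in that] left[OF s_in] by linarith
  have t_eq: "d v t = L" using right_ge[OF t_in] t(2) by linarith
  have left_eq': "d v r = L" if "r \<in> \<sigma> (i - 1)" for r
    using left_eq[OF that] dist_sym[of v r] by simp
  have left_ge: "L \<le> d q r" if "q \<in> \<sigma> i" "r \<in> \<sigma> (i - 1)" for q r
    using transverse_next[of "i - 1"] that dist_sym[of q r]
    unfolding transverse_dist_def by simp
  have s_eq: "d q s = L" if "q \<in> \<sigma> i" for q
    using forward_dist[OF s, of q] that dist_sym[of q s] by simp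
  obtain f where f: "f \<in> forward i" using forward_nonempty by blast

  have "insert v (\<sigma> i) = \<sigma> i"
  proof (rule clique_maximal)
    show "clique V E (insert v (\<sigma> i))"
      unfolding clique_iff_diameter_le_1
      using \<open>v \<in> V\<close> middle dist_sym[of v] sigma_in_V sigma_diameter by auto
    show "transverse_dist E (insert v (\<sigma> i)) (\<sigma> (i + 1)) L"
      unfolding transverse_dist_def
    proof (intro conjI)
      show "\<forall>x\<in>insert v (\<sigma> i). \<forall>y\<in>\<sigma> (i + 1). L \<le> d x y"
        using right_ge transverse_next[of i] unfolding transverse_dist_def by blast
      show "\<exists>x\<in>insert v (\<sigma> i). \<forall>y\<in>\<sigma> (i + 1). d x y = L"
        using f unfolding forward_def by blast
      show "\<exists>y\<in>\<sigma> (i + 1). \<forall>x\<in>insert v (\<sigma> i). d x y = L"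
        using t_in t_eq backward_dist[OF t(1)] by auto
    qed
    show "transverse_dist E (insert v (\<sigma> i)) (\<sigma> (i - 1)) L"
      unfolding transverse_dist_def
    proof (intro conjI)
      show "\<forall>x\<in>insert v (\<sigma> i). \<forall>y\<in>\<sigma> (i - 1). L \<le> d x y"
        using left_eq' left_ge by auto
      show "\<exists>x\<in>insert v (\<sigma> i). \<forall>y\<in>\<sigma> (i - 1). d x y = L"
        using left_eq' by auto
      show "\<exists>y\<in>\<sigma> (i - 1). \<forall>x\<in>insert v (\<sigma> i). d x y = L"
        using s_in left_eq'[OF s_in] s_eq by auto
    qed
  qed auto
  then show ?thesis
    unfolding backward_def using left_eq by auto
qed


section \<open>Distances along the path\<close>

text \<open>
  The balls of the Helly argument are chosen with the radii that \<open>between_imp_backward\<close> needs,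
  except for the ball around \<open>x\<close>, whose radius is one less than the induction hypothesis permits
  for a backward vertex.  Apart from the bound to be refuted, the distance bounds that make these
  balls meet hold between a forward or backward vertex and a whole clique, inside a clique, or
  between consecutive cliques.  For arbitrary end vertices \<open>x\<close> and \<open>t\<close> some of them fail, which is
  why the induction is about forward and backward vertices; the vertex it produces is again a
  backward one.
\<close>

lemma forward_backward_dist:
  assumes Helly: "Helly_graph V E"
    and "x \<in> forward i" "t \<in> backward (i + 1 + int n)"
  shows "Suc n * L \<le> d x t"
  using assms(3)
proof (induction n arbitrary: t)
  case 0
  then show ?case
    using forward_dist[OF assms(2)] backward_in_sigma by simp
next
  case (Suc n)
  define k where "k = i + 1 + int n"
  have t: "t \<in> backward (k + 1)"
    using Suc.prems by (simp add: k_def algebra_simps)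
  have t_in: "t \<in> \<sigma> (k + 1)" using backward_in_sigma[OF t] .
  have x_in: "x \<in> \<sigma> i" using forward_in_sigma[OF assms(2)] .
  show ?case
  proof (cases n)
    \<comment> \<open>Two steps need a separate argument: \<open>\<sigma> (k - 1)\<close> is then the clique \<open>\<sigma> i\<close> of \<open>x\<close> itself,
        so \<open>forward_dist_le\<close> does not bound the distance from \<open>x\<close> to it.\<close>
    case 0
    then show ?thesis
      using sigma_next2_dist[OF x_in, of t] t_in by (simp add: k_def algebra_simps)
  next
    case (Suc m)
    have x_left: "d x r \<le> n * L" if "r \<in> \<sigma> (k - 1)" for r
      using forward_dist_le[OF assms(2), of r m] that by (simp add: k_def Suc algebra_simps)
    have x_middle: "d x q \<le> Suc n * L" if "q \<in> \<sigma> k" for q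
      using forward_dist_le[OF assms(2), of q n] that by (simp add: k_def)
    have left_t: "d r t \<le> 2 * L" if "r \<in> \<sigma> (k - 1)" for r
      using backward_dist_le[OF t, of r 1] that by (simp add: algebra_simps)
    have middle_t: "d q t = L" if "q \<in> \<sigma> k" for q
      using backward_dist[OF t] that by simp
    have left_middle: "d r q \<le> L + 1" if "r \<in> \<sigma> (k - 1)" "q \<in> \<sigma> k" for r q
      using sigma_next_dist[of r "k - 1" q] that by simp
    show ?thesis
    proof (rule ccontr)
      assume "\<not> ?thesis"
      then have xt: "d x t < Suc (Suc n) * L" by simp
      define R where "R = Suc n * L - 1"
      have R: "R + 1 = Suc n * L"
        using L by (simp add: R_def)
      \<comment> \<open>the balls of radius \<open>a\<close> around \<open>c\<close> and \<open>a'\<close> around \<open>c'\<close> meet\<close>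
      define close where "close c a c' a' \<longleftrightarrow> d c c' \<le> a + a'" for c a c' a'
      have close_sym: "close c' a' c a" if "close c a c' a'" for c a c' a'
        using that dist_sym[of c c'] by (simp add: close_def add.commute)
      have close_self: "close c a c a" for c a
        by (simp add: close_def)
      have close_x_t: "close x R t L"
        using xt R by (simp add: close_def)
      have close_x_left: "close x R r L" if "r \<in> \<sigma> (k - 1)" for r
        using x_left[OF that] R L by (simp add: close_def)
      have close_x_middle: "close x R q 1" if "q \<in> \<sigma> k" for q
        using x_middle[OF that] R by (simp add: close_def)
      have close_left_t: "close r L t L" if "r \<in> \<sigma> (k - 1)" for r
        using left_t[OF that] by (simp add: close_def)
      have close_middle_t: "close q 1 t L" if "q \<in> \<sigma> k" for q
        using middle_t[OF that] by (simp add: close_def)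
      have close_left_middle: "close r L q 1" if "r \<in> \<sigma> (k - 1)" "q \<in> \<sigma> k" for r q
        using left_middle[OF that] by (simp add: close_def)
      have close_left: "close r L r' L" if "r \<in> \<sigma> (k - 1)" "r' \<in> \<sigma> (k - 1)" for r r'
        using sigma_diameter[OF that] L by (simp add: close_def)
      have close_middle: "close q 1 q' 1" if "q \<in> \<sigma> k" "q' \<in> \<sigma> k" for q q'
        using sigma_diameter[OF that] by (simp add: close_def)
      note close_facts = close_x_t close_x_left close_x_middle close_left_t close_middle_t
        close_left_middle
      define P where
        "P = {(x, R), (t, L)} \<union> (\<lambda>r. (r, L)) ` \<sigma> (k - 1) \<union> (\<lambda>q. (q, 1)) ` \<sigma> k"
      have P_cases: "(c = x \<and> a = R) \<or> (c = t \<and> a = L) \<or> (c \<in> \<sigma> (k - 1) \<and> a = L)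
          \<or> (c \<in> \<sigma> k \<and> a = 1)" if "(c, a) \<in> P" for c a
        using that unfolding P_def by auto
      obtain v where v: "v \<in> V" "\<And>c a. (c, a) \<in> P \<Longrightarrow> d c v \<le> a"
      proof (rule Helly_common_point[OF Helly, of P])
        show "c \<in> V" if "(c, a) \<in> P" for c a
          using P_cases[OF that] x_in t_in sigma_in_V by blast
        show "P \<noteq> {}" unfolding P_def by blast
        show "d c c' \<le> a + a'" if "(c, a) \<in> P" "(c', a') \<in> P" for c a c' a'
          using P_cases[OF that(1)] P_cases[OF that(2)] unfolding close_def[symmetric]
          by (elim disjE conjE; hypsubst)
            (assumption | rule close_self close_facts close_facts[THEN close_sym]
              close_left close_middle)+
      qed blast
      have "v \<in> backward k"
      proof (rule between_imp_backward)
        show "d v t \<le> L" using v(2)[of t L] dist_sym[of v] by (simp add: P_def)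
        show "d r v \<le> L" if "r \<in> \<sigma> (k - 1)" for r
          using v(2)[of r L] that by (simp add: P_def)
        show "d q v \<le> 1" if "q \<in> \<sigma> k" for q
          using v(2)[of q 1] that by (simp add: P_def)
      qed (use v(1) t in auto)
      then have "Suc n * L \<le> d x v"
        using Suc.IH by (simp add: k_def)
      moreover have "d x v \<le> R" using v(2)[of x R] by (simp add: P_def)
      ultimately show False using R by linarith
    qed
  qed
qed

lemma sigma_dist_ge:
  assumes Helly: "Helly_graph V E"
    and "u \<in> \<sigma> i" "w \<in> \<sigma> (i + 1 + int n)"
  shows "Suc n * L \<le> d u w"
proof -
  obtain x where x: "x \<in> forward (i - 1)" using forward_nonempty by blast
  obtain t where t: "t \<in> backward (i + 1 + int n + 1)" using backward_nonempty by blast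
  have in_V: "x \<in> V" "t \<in> V" "u \<in> V" "w \<in> V"
    using x t assms(2,3) by (auto intro: sigma_in_V forward_in_sigma backward_in_sigma)
  have "Suc (Suc (Suc n)) * L \<le> d x t"
    using forward_backward_dist[OF Helly x, of t "Suc (Suc n)"] t
    by (simp add: algebra_simps)
  moreover have "d x t \<le> d x u + d u t" "d u t \<le> d u w + d w t"
    using in_V dist_triangle by blast+
  moreover have "d x u = L" using forward_dist[OF x, of u] assms(2) by simp
  moreover have "d w t = L" using backward_dist[OF t, of w] assms(3) by (simp add: algebra_simps)
  ultimately show ?thesis by simp
qed

lemma transverse_all:
  assumes Helly: "Helly_graph V E" and "i < j"
  shows "transverse_dist E (\<sigma> i) (\<sigma> j) (nat (j - i) * L)"
proof -
  define n where "n = nat (j - i) - 1"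
  have j: "j = i + 1 + int n" and i: "i = j - 1 - int n" and n: "nat (j - i) = Suc n"
    using \<open>i < j\<close> by (auto simp: n_def)
  have ge: "Suc n * L \<le> d u w" if "u \<in> \<sigma> i" "w \<in> \<sigma> j" for u w
    using sigma_dist_ge[OF Helly] that j by blast
  obtain x where x: "x \<in> forward i" using forward_nonempty by blast
  have "d x w = Suc n * L" if "w \<in> \<sigma> j" for w
    using forward_dist_le[OF x, of w n] ge[OF forward_in_sigma[OF x] that] that j by simp
  moreover obtain y where y: "y \<in> backward j" using backward_nonempty by blast
  have "d u y = Suc n * L" if "u \<in> \<sigma> i" for u
    using backward_dist_le[OF y, of u n] ge[OF that backward_in_sigma[OF y]] that i by simp
  ultimately show ?thesis
    unfolding transverse_dist_def n
    using ge forward_in_sigma[OF x] backward_in_sigma[OF y] by blast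
qed

end


section \<open>Local clique-paths are clique-paths\<close>

theorem theorem5p5:
  fixes V :: "'v set" and E :: "'v rel"
    and H :: "'b metric" and e :: "'v \<Rightarrow> 'b"
    and L :: nat and \<sigma> :: "int \<Rightarrow> 'v set"
  assumes Helly: "Helly_graph V E"
    and hull: "injective_hull V (\<lambda>x y. real (graph_dist E x y)) H e"
    and finite_combinatorial_dim: "topological_dim (mtopology_of H) < \<infinity>"
    and L: "L \<ge> 1"
    and local_path: "local_clique_path V E L UNIV \<sigma>"
  shows "clique_path V E L UNIV \<sigma>"
proof -
  interpret biinfinite_local_clique_path V E L \<sigma>
    using Helly L local_path unfolding Helly_graph_def by unfold_locales auto
  have "disjoint_clique_sequence V E UNIV \<sigma>"
    using local_path unfolding local_clique_path_def by blast
  then show ?thesis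
    unfolding clique_path_def using transverse_all[OF Helly] clique_maximal by blast
qed

end
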